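(* Let $n\ge 2$ and let $\{f_i\}_{i=1}^k$ be a sequence of vectors in $\mathbb{C}^n$, not all of which are zero. Then $\{f_i\}_{i=1}^k$ is a tight frame for $\mathbb{C}^n$ if and only if $\sum_{i=1}^k\tilde f_i=0$.
   Context: $\mathbb{C}^n$ carries its standard inner product; $f(i)$ denotes the $i$-th coordinate of $f$. A finite sequence $\{f_i\}_{i=1}^k$ in $\mathbb{C}^n$ is a tight frame if there is $\lambda>0$ with $\sum_{i=1}^k|\langle f,f_i\rangle|^2=\lambda\|f\|^2$ for all $f\in\mathbb{C}^n$. Diagram vector ($n\ge2$): for $f\in\mathbb{C}^n$, $\tilde f\in\mathbb{C}^{3n(n-1)/2}$ is $\frac{1}{\sqrt{n-1}}$ times the vector whose entries are $f(i)\overline{f(i)}-f(j)\overline{f(j)}$ (once for each pair $i<j$) and $\sqrt{n}\,f(i)\overline{f(j)}$ (once for each ordered pair $i\ne j$), in a fixed order that is the same for all $f$. *)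

theory Defs
  imports Complex_Main "Jordan_Normal_Form.Matrix"
begin

text \<open>Vectors in \<open>\<complex>\<^sup>n\<close> are elements of \<^term>\<open>carrier_vec n :: complex vec set\<close>, whose
  coordinates are numbered \<open>0, \<dots>, n - 1\<close>. The inner product
  \<open>v \<bullet>c w = (\<Sum>i<n. v(i) * cnj (w(i)))\<close> is linear in its first argument.\<close>

definition cvec_norm :: "complex vec \<Rightarrow> real" where
  "cvec_norm f = sqrt (Re (f \<bullet>c f))"

definition tight_frame :: "nat \<Rightarrow> nat \<Rightarrow> (nat \<Rightarrow> complex vec) \<Rightarrow> bool" where
  "tight_frame n k F \<longleftrightarrow>
     (\<forall>i\<in>{1..k}. F i \<in> carrier_vec n) \<and>
     (\<exists>c::real. c > 0 \<and>
        (\<forall>f\<in>carrier_vec n. (\<Sum>i=1..k. (cmod (f \<bullet>c F i))\<^sup>2) = c * (cvec_norm f)\<^sup>2))"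

definition ordered_pairs :: "nat \<Rightarrow> (nat \<times> nat) list" where
  "ordered_pairs n = filter (\<lambda>(i, j). i \<noteq> j) (List.product [0..<n] [0..<n])"

definition increasing_pairs :: "nat \<Rightarrow> (nat \<times> nat) list" where
  "increasing_pairs n = filter (\<lambda>(i, j). i < j) (List.product [0..<n] [0..<n])"

text \<open>The order of the entries: first all differences, then all mixed products, each group
  lexicographically by \<open>(i, j)\<close>. Only meant for \<open>n \<ge> 2\<close> and \<open>f\<close> of dimension \<open>n\<close>.\<close>

definition diagram_vector :: "nat \<Rightarrow> complex vec \<Rightarrow> complex vec" where
  "diagram_vector n f =
     complex_of_real (1 / sqrt (real n - 1)) \<cdot>\<^sub>v
       vec_of_list
         (map (\<lambda>(i, j). f $ i * cnj (f $ i) - f $ j * cnj (f $ j)) (increasing_pairs n) @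
          map (\<lambda>(i, j). complex_of_real (sqrt (real n)) * f $ i * cnj (f $ j)) (ordered_pairs n))"

lemma distinct_ordered_pairs: "distinct (ordered_pairs n)"
  and set_ordered_pairs: "set (ordered_pairs n) = {(i, j). i < n \<and> j < n \<and> i \<noteq> j}"
  unfolding ordered_pairs_def by (auto intro!: distinct_filter distinct_product)

lemma distinct_increasing_pairs: "distinct (increasing_pairs n)"
  and set_increasing_pairs: "set (increasing_pairs n) = {(i, j). i < j \<and> j < n}"
  unfolding increasing_pairs_def by (auto intro!: distinct_filter distinct_product)

lemma length_ordered_pairs: "length (ordered_pairs n) = n * (n - 1)"
proof -
  have "set (ordered_pairs n) = {..<n} \<times> {..<n} - (\<lambda>i. (i, i)) ` {..<n}"
    by (auto simp: set_ordered_pairs)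
  moreover have "card ({..<n} \<times> {..<n} - (\<lambda>i. (i, i)) ` {..<n}) = n * n - n"
    by (subst card_Diff_subset) (auto simp: card_image inj_on_def)
  ultimately show ?thesis
    using distinct_card[OF distinct_ordered_pairs, of n] by (simp add: algebra_simps)
qed

lemma length_increasing_pairs: "2 * length (increasing_pairs n) = n * (n - 1)"
proof -
  let ?U = "set (increasing_pairs n)"
  have "set (ordered_pairs n) = ?U \<union> prod.swap ` ?U"
    by (auto simp: set_ordered_pairs set_increasing_pairs image_iff)
  moreover have "card (?U \<union> prod.swap ` ?U) = card ?U + card (prod.swap ` ?U)"
  proof (rule card_Un_disjoint)
    show "?U \<inter> prod.swap ` ?U = {}"
      by (auto simp: set_increasing_pairs)
  qed simp_all
  moreover have "card (prod.swap ` ?U) = card ?U"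
    by (rule card_image) auto
  ultimately show ?thesis
    using distinct_card[OF distinct_ordered_pairs, of n] length_ordered_pairs[of n]
      distinct_card[OF distinct_increasing_pairs, of n] by simp
qed

lemma diagram_vector_carrier: "diagram_vector n f \<in> carrier_vec (3 * n * (n - 1) div 2)"
proof (rule carrier_vecI)
  have "dim_vec (diagram_vector n f) = length (increasing_pairs n) + length (ordered_pairs n)"
    by (simp add: diagram_vector_def)
  moreover have "3 * n * (n - 1) = 3 * (2 * length (increasing_pairs n))"
    unfolding length_increasing_pairs by simp
  moreover have "length (ordered_pairs n) = 2 * length (increasing_pairs n)"
    unfolding length_increasing_pairs length_ordered_pairs ..
  ultimately show "dim_vec (diagram_vector n f) = 3 * n * (n - 1) div 2"
    by presburger
qed

end

theory Submission
  imports Defs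
begin

text \<open>Let \<open>S a b = (\<Sum>i. F i (a) * cnj (F i (b)))\<close> be the entries of the frame operator. The frame
  is tight with constant \<open>c\<close> iff \<open>S = c I\<close>: expand the quadratic form of \<open>S\<close> in one direction, and
  polarise it by testing on \<open>e\<^sub>a + z e\<^sub>b\<close> with \<open>z = 0, 1, \<i>\<close> in the other. The diagram vectors add
  up to a vector whose entries are, up to nonzero factors, the differences of the diagonal entries
  of \<open>S\<close> and the off-diagonal entries of \<open>S\<close>; it vanishes iff \<open>S\<close> is scalar.\<close>

definition frame_operator_entry ::
    "nat \<Rightarrow> (nat \<Rightarrow> complex vec) \<Rightarrow> nat \<Rightarrow> nat \<Rightarrow> complex" where
  "frame_operator_entry k F a b = (\<Sum>i=1..k. F i $ a * cnj (F i $ b))"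

lemma cscalar_prod_eq_sum:
  assumes "f \<in> carrier_vec n" "g \<in> carrier_vec n"
  shows "f \<bullet>c g = (\<Sum>a<n. f $ a * cnj (g $ a))"
  using assms by (auto simp: scalar_prod_def atLeast0LessThan)

text \<open>The inner product of \<open>f\<close> with itself is a sum of squared moduli, hence real
  and nonnegative, so neither \<open>Re\<close> nor \<open>sqrt\<close> in \<open>cvec_norm\<close>
  loses anything.\<close>

lemma of_real_cvec_norm_square:
  assumes "f \<in> carrier_vec n"
  shows "complex_of_real ((cvec_norm f)\<^sup>2) = f \<bullet>c f"
proof -
  have *: "f \<bullet>c f = complex_of_real (\<Sum>a<n. (cmod (f $ a))\<^sup>2)"
    unfolding cscalar_prod_eq_sum[OF assms assms] of_real_sum complex_norm_square ..
  show ?thesis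
    unfolding cvec_norm_def * by (simp add: sum_nonneg)
qed

text \<open>Multiply each inner product by its conjugate and move the sum over \<open>i\<close>
  innermost. The indices of the entry come out reversed because \<open>F i\<close> stands in the
  conjugated slot.\<close>

lemma sum_cmod_cscalar_prod_square:
  assumes "\<And>i. i \<in> {1..k} \<Longrightarrow> F i \<in> carrier_vec n" "f \<in> carrier_vec n"
  shows "complex_of_real (\<Sum>i=1..k. (cmod (f \<bullet>c F i))\<^sup>2) =
    (\<Sum>a<n. \<Sum>b<n. f $ a * cnj (f $ b) * frame_operator_entry k F b a)"
proof -
  have "complex_of_real (\<Sum>i=1..k. (cmod (f \<bullet>c F i))\<^sup>2) =
      (\<Sum>i=1..k. (f \<bullet>c F i) * cnj (f \<bullet>c F i))"
    unfolding of_real_sum complex_norm_square ..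
  also have "\<dots> = (\<Sum>i=1..k. \<Sum>a<n. \<Sum>b<n. f $ a * cnj (f $ b) * (F i $ b * cnj (F i $ a)))"
    by (rule sum.cong[OF refl])
      (simp only: cscalar_prod_eq_sum[OF assms(2) assms(1)] cnj_sum sum_product,
        auto intro!: sum.cong)
  also have "\<dots> = (\<Sum>a<n. \<Sum>b<n. \<Sum>i=1..k. f $ a * cnj (f $ b) * (F i $ b * cnj (F i $ a)))"
    by (subst sum.swap, rule sum.cong[OF refl], subst sum.swap, rule refl)
  finally show ?thesis
    by (simp add: frame_operator_entry_def sum_distrib_left)
qed

lemma unit_vec_add_smult_cscalar_prod:
  fixes z :: complex
  assumes "a < n" "b < n" "v \<in> carrier_vec n"
  shows "(unit_vec n a + z \<cdot>\<^sub>v unit_vec n b) \<bullet>c v = cnj (v $ a) + z * cnj (v $ b)"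
  using assms by (simp add: add_scalar_prod_distrib[where n = n])

lemma frame_operator_scalar_if_tight:
  assumes F: "\<And>i. i \<in> {1..k} \<Longrightarrow> F i \<in> carrier_vec n"
    and Q: "\<And>f. f \<in> carrier_vec n \<Longrightarrow>
      (\<Sum>i=1..k. (cmod (f \<bullet>c F i))\<^sup>2) = c * (cvec_norm f)\<^sup>2"
    and ab: "a < n" "b < n"
  shows "frame_operator_entry k F a b = (if a = b then complex_of_real c else 0)"
proof -
  let ?S = "frame_operator_entry k F"
  have diag: "?S a a = complex_of_real c" if "a < n" for a
  proof -
    have *: "unit_vec n a \<bullet>c v = cnj (v $ a)" if "v \<in> carrier_vec n" for v :: "complex vec"
      using that \<open>a < n\<close> by simp
    have "?S a a = complex_of_real (\<Sum>i=1..k. (cmod (unit_vec n a \<bullet>c F i))\<^sup>2)"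
      unfolding of_real_sum complex_norm_square frame_operator_entry_def
      by (rule sum.cong) (simp_all only: * F, simp)
    also have "\<dots> = complex_of_real c * (unit_vec n a \<bullet>c unit_vec n a)"
      by (subst Q) (simp_all only: of_real_mult of_real_cvec_norm_square[OF unit_vec_carrier] unit_vec_carrier)
    finally show ?thesis
      using that by simp
  qed
  \<comment> \<open>On \<open>e_a + z e_b\<close> the diagonal entries contribute
    \<open>c + z * cnj z * c\<close>, which is exactly \<open>c\<close> times the squared norm, so
    the cross terms must cancel.\<close>
  have off: "z * ?S a b + cnj z * ?S b a = 0" if "a \<noteq> b" for z
  proof -
    let ?f = "unit_vec n a + z \<cdot>\<^sub>v unit_vec n b"
    have f: "?f \<in> carrier_vec n"
      by simp
    have expand: "(?f \<bullet>c F i) * cnj (?f \<bullet>c F i) =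
        F i $ a * cnj (F i $ a) + z * cnj z * (F i $ b * cnj (F i $ b)) +
        (z * (F i $ a * cnj (F i $ b)) + cnj z * (F i $ b * cnj (F i $ a)))"
      if "i \<in> {1..k}" for i
      unfolding unit_vec_add_smult_cscalar_prod[OF ab F[OF that]] by (simp add: algebra_simps)
    have "?S a a + z * cnj z * ?S b b + (z * ?S a b + cnj z * ?S b a) =
        complex_of_real (\<Sum>i=1..k. (cmod (?f \<bullet>c F i))\<^sup>2)"
      unfolding of_real_sum complex_norm_square frame_operator_entry_def
        sum_distrib_left sum.distrib[symmetric]
      by (rule sum.cong[OF refl]) (rule expand[symmetric])
    also have "\<dots> = complex_of_real c * (?f \<bullet>c ?f)"
      by (simp only: Q[OF f] of_real_mult of_real_cvec_norm_square[OF f])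
    also have "?f \<bullet>c ?f = 1 + z * cnj z"
      unfolding unit_vec_add_smult_cscalar_prod[OF ab f] using ab that by simp
    finally show ?thesis
      using ab by (simp add: diag algebra_simps)
  qed
  show ?thesis
    \<comment> \<open>For \<open>a \<noteq> b\<close>, \<open>z = 1\<close> gives
      \<open>?S a b + ?S b a = 0\<close> and \<open>z = \<i>\<close> gives
      \<open>?S a b - ?S b a = 0\<close>.\<close>
    using diag[OF ab(1)] off[of 1] off[of \<i>]
    by (auto simp: algebra_simps complex_eq_iff)
qed

text \<open>The scalar on the right is an arbitrary complex number. It is real and positive because
  it is a diagonal entry of \<open>S\<close>, a sum of squared moduli, and some \<open>F i\<close>
  is nonzero.\<close>

lemma tight_frame_iff_frame_operator_scalar:
  assumes F: "\<And>i. i \<in> {1..k} \<Longrightarrow> F i \<in> carrier_vec n"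
    and nz: "\<exists>i\<in>{1..k}. F i \<noteq> 0\<^sub>v n"
  shows "tight_frame n k F \<longleftrightarrow>
    (\<exists>c. \<forall>a<n. \<forall>b<n. frame_operator_entry k F a b = (if a = b then c else 0))"
    (is "_ \<longleftrightarrow> ?scalar")
proof
  assume "tight_frame n k F"
  then obtain c :: real where "\<And>f. f \<in> carrier_vec n \<Longrightarrow>
      (\<Sum>i=1..k. (cmod (f \<bullet>c F i))\<^sup>2) = c * (cvec_norm f)\<^sup>2"
    unfolding tight_frame_def by blast
  from frame_operator_scalar_if_tight[OF F this] show ?scalar
    by blast
next
  let ?S = "frame_operator_entry k F"
  assume ?scalar
  then obtain c where c: "\<And>a b. \<lbrakk>a < n; b < n\<rbrakk> \<Longrightarrow> ?S a b = (if a = b then c else 0)"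
    by blast
  \<comment> \<open>A nonzero coordinate \<open>a\<close> of some \<open>F i\<close> singles out a
    diagonal entry that is certainly positive; \<open>d\<close> is its real value.\<close>
  obtain i a where ia: "i \<in> {1..k}" "a < n" "F i $ a \<noteq> 0"
  proof -
    obtain i where i: "i \<in> {1..k}" "F i \<noteq> 0\<^sub>v n"
      using nz by blast
    moreover have "\<exists>a<n. F i $ a \<noteq> 0"
      using i F[OF i(1)] by (auto simp: vec_eq_iff)
    ultimately show thesis
      using that by blast
  qed
  define d where "d = (\<Sum>j=1..k. (cmod (F j $ a))\<^sup>2)"
  have "d > 0"
    unfolding d_def by (rule sum_pos2[OF _ ia(1)]) (use ia(3) in auto)
  have "complex_of_real d = ?S a a"
    unfolding d_def frame_operator_entry_def of_real_sum complex_norm_square ..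
  then have cd: "c = complex_of_real d"
    using c[OF ia(2) ia(2)] by simp
  have "(\<Sum>i=1..k. (cmod (f \<bullet>c F i))\<^sup>2) = d * (cvec_norm f)\<^sup>2" if f: "f \<in> carrier_vec n" for f
  proof -
    have "complex_of_real (\<Sum>i=1..k. (cmod (f \<bullet>c F i))\<^sup>2) =
        (\<Sum>p<n. \<Sum>q<n. f $ p * cnj (f $ q) * (if q = p then c else 0))"
      by (subst sum_cmod_cscalar_prod_square[OF F f]) (auto intro!: sum.cong simp: c)
    also have "\<dots> = (\<Sum>p<n. f $ p * cnj (f $ p) * c)"
      by (simp add: if_distrib[of "(*) _"] cong: if_cong)
    also have "\<dots> = c * (\<Sum>p<n. f $ p * cnj (f $ p))"
      by (simp only: sum_distrib_left mult.commute[of c])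
    also have "\<dots> = complex_of_real (d * (cvec_norm f)\<^sup>2)"
      by (simp only: of_real_mult of_real_cvec_norm_square[OF f] cscalar_prod_eq_sum[OF f f] cd)
    finally show ?thesis
      by (simp only: of_real_eq_iff)
  qed
  then show "tight_frame n k F"
    using F \<open>d > 0\<close> unfolding tight_frame_def by blast
qed

lemma sum_diagram_vector_eq_0_iff:
  assumes "n \<ge> 2"
  shows "finsum_vec TYPE(complex) (3 * n * (n - 1) div 2) (\<lambda>i. diagram_vector n (F i)) {1..k}
      = 0\<^sub>v (3 * n * (n - 1) div 2) \<longleftrightarrow>
    (\<forall>(a, b)\<in>set (increasing_pairs n).
      frame_operator_entry k F a a = frame_operator_entry k F b b) \<and>
    (\<forall>(a, b)\<in>set (ordered_pairs n). frame_operator_entry k F a b = 0)"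
proof -
  let ?S = "frame_operator_entry k F" and ?m = "3 * n * (n - 1) div 2"
  let ?v = "finsum_vec TYPE(complex) ?m (\<lambda>i. diagram_vector n (F i)) {1..k}"
  define r where "r = complex_of_real (1 / sqrt (real n - 1))"
  define s where "s = complex_of_real (sqrt (real n))"
  \<comment> \<open>Here \<open>n \<ge> 2\<close> matters: \<open>n = 1\<close> would give
    \<open>r = 0\<close>, as division by zero yields zero, and \<open>n = 0\<close> would give
    \<open>s = 0\<close>.\<close>
  have nz: "r \<noteq> 0" "s \<noteq> 0"
    using assms by (auto simp: r_def s_def)
  \<comment> \<open>\<open>L f\<close> lists the entries of the diagram vector without the factor
    \<open>r\<close>; \<open>T\<close> is the same list with each product
    \<open>f $ a * cnj (f $ b)\<close> replaced by \<open>?S a b\<close>.\<close>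
  define L where "L = (\<lambda>f :: complex vec.
      map (\<lambda>(a, b). f $ a * cnj (f $ a) - f $ b * cnj (f $ b)) (increasing_pairs n) @
      map (\<lambda>(a, b). s * f $ a * cnj (f $ b)) (ordered_pairs n))"
  define T where "T = map (\<lambda>(a, b). ?S a a - ?S b b) (increasing_pairs n) @
      map (\<lambda>(a, b). s * ?S a b) (ordered_pairs n)"
  have D: "diagram_vector n f = r \<cdot>\<^sub>v vec_of_list (L f)" for f
    unfolding diagram_vector_def r_def s_def L_def ..
  have lenL: "length (L f) = ?m" for f
    using carrier_vecD[OF diagram_vector_carrier[of n f]]
    by (simp only: D index_smult_vec dim_vec_of_list)
  have lenT: "length T = ?m"
    \<comment> \<open>The length of \<open>L f\<close> does not depend on \<open>f\<close>;
      \<open>F 0\<close>, outside the summation range, is an arbitrary choice.\<close>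
    using lenL[of "F 0"] by (simp add: T_def L_def)
  \<comment> \<open>Entries of \<open>L f\<close> are linear in the products
    \<open>f $ a * cnj (f $ b)\<close>, and \<open>L\<close> and \<open>T\<close> switch from
    differences to mixed products at the same position.\<close>
  have sumL: "(\<Sum>i=1..k. L (F i) ! p) = T ! p" if "p < ?m" for p
    using that lenT
    by (auto simp: L_def T_def nth_append frame_operator_entry_def sum_subtractf
        sum_distrib_left mult.assoc split: prod.split)
  have "?v $ p = r * T ! p" if p: "p < ?m" for p
  proof -
    have "?v $ p = (\<Sum>i=1..k. diagram_vector n (F i) $ p)"
      by (rule index_finsum_vec) (use p diagram_vector_carrier in auto)
    also have "\<dots> = (\<Sum>i=1..k. r * L (F i) ! p)"
      using p lenL by (simp add: D vec_of_list_index)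
    finally show ?thesis
      using sumL[OF p] by (simp add: sum_distrib_left[symmetric])
  qed
  moreover have "dim_vec ?v = ?m"
    by (rule carrier_vecD, rule finsum_vec_closed) (use diagram_vector_carrier in auto)
  ultimately have "?v = 0\<^sub>v ?m \<longleftrightarrow> (\<forall>p<length T. T ! p = 0)"
    using nz lenT by (auto simp: vec_eq_iff)
  also have "\<dots> \<longleftrightarrow> (\<forall>x\<in>set T. x = 0)"
    by (simp add: all_set_conv_all_nth)
  finally show ?thesis
    using nz by (simp add: T_def ball_Un case_prod_beta)
qed

theorem proposition2p8:
  fixes n k :: nat and F :: "nat \<Rightarrow> complex vec"
  assumes "n \<ge> 2"
    and "\<And>i. i \<in> {1..k} \<Longrightarrow> F i \<in> carrier_vec n"
    and "\<exists>i\<in>{1..k}. F i \<noteq> 0\<^sub>v n"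
  shows "tight_frame n k F \<longleftrightarrow>
    finsum_vec TYPE(complex) (3 * n * (n - 1) div 2) (\<lambda>i. diagram_vector n (F i)) {1..k}
      = 0\<^sub>v (3 * n * (n - 1) div 2)"
proof -
  let ?S = "frame_operator_entry k F"
  have "(\<exists>c. \<forall>a<n. \<forall>b<n. ?S a b = (if a = b then c else 0)) \<longleftrightarrow>
      (\<forall>(a, b)\<in>set (increasing_pairs n). ?S a a = ?S b b) \<and>
      (\<forall>(a, b)\<in>set (ordered_pairs n). ?S a b = 0)" (is "?scalar \<longleftrightarrow> ?zero")
  proof
    show ?zero if ?scalar
      using that by (auto simp: set_increasing_pairs set_ordered_pairs)
  next
    assume zero: ?zero
    \<comment> \<open>Every pair \<open>(0, a)\<close> with \<open>0 < a < n\<close> is increasing,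
      so \<open>?S 0 0\<close> serves as the common diagonal value \<open>c\<close>.\<close>
    have "?S a a = ?S 0 0" if "a < n" for a
      using zero that by (cases "a = 0") (auto simp: set_increasing_pairs)
    moreover have "?S a b = 0" if "a < n" "b < n" "a \<noteq> b" for a b
      using zero that by (auto simp: set_ordered_pairs)
    ultimately show ?scalar
      by metis
  qed
  moreover have "tight_frame n k F \<longleftrightarrow> ?scalar"
    using assms(2,3) by (rule tight_frame_iff_frame_operator_scalar)
  ultimately show ?thesis
    unfolding sum_diagram_vector_eq_0_iff[OF assms(1)] by (rule trans[rotated])
qed

end
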